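(* Let $\check J>0$, $\rho>0$, $\mathbf a\in\mathbb R^L$, and consider the (generally nonconvex) quadratic program with one quadratic constraint $$\min_{\mathbf w\in\mathbb R^L}\ \mathbf w^T\boldsymbol\Omega_T\mathbf w+\tfrac{\rho}{2}\|\mathbf w-\mathbf a\|_2^2\quad\text{subject to}\quad \mathbf w^T(\check J\,\boldsymbol\Omega_{JD}-\boldsymbol\Omega_{JN})\mathbf w+\check J\xi^2\le 0. \qquad (\ast)$$ Let $\tilde{\boldsymbol\Omega}_T=\boldsymbol\Omega_T+\frac{\rho}{2}\mathbf I$, and let $\mathbf U$ be orthogonal and $\boldsymbol\Lambda=\mathrm{diag}(\lambda_1,\dots,\lambda_L)$ be such that $$\frac{1}{\check J\xi^2}\tilde{\boldsymbol\Omega}_T^{-1/2}(\check J\,\boldsymbol\Omega_{JD}-\boldsymbol\Omega_{JN})\tilde{\boldsymbol\Omega}_T^{-1/2}=\mathbf U\boldsymbol\Lambda\mathbf U^T .$$ Put $\mathbf q=-\frac{\rho}{2}\mathbf U^T\tilde{\boldsymbol\Omega}_T^{-1/2}\mathbf a$ with entries $q_l$. Then the KKT-based solution of $(\ast)$ is $\mathbf w=\tilde{\boldsymbol\Omega}_T^{-1/2}\mathbf U\mathbf u$, where $$\mathbf u=\begin{cases}-\mathbf q & \text{if }\mathbf q^T\boldsymbol\Lambda\mathbf q+1\le 0,\\ -(\mathbf I+\mu_0\boldsymbol\Lambda)^{-1}\mathbf q & \text{otherwise,}\end{cases}$$ and $\mu_0$ is a positive root (with $\mu_0\lambda_l+1\ne0$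 for all $l$) of the equation in $\mu$ $$f(\mu):=\sum_{l=1}^L\frac{\lambda_l q_l^2}{(\mu\lambda_l+1)^2}+1=0 .$$ That is, the vector $\mathbf w$ so defined (in the second case, for any such root $\mu_0$) satisfies the KKT conditions of $(\ast)$ (primal feasibility, and existence of a nonnegative multiplier satisfying complementary slackness and stationarity of the Lagrangian).
   Context: Let $N\ge1$, $L=N^2$. Given: $\eta^2>0$, $\xi^2>0$, vectors $\mathbf h,\mathbf g\in\mathbb R^N$, and symmetric positive definite $N\times N$ matrices $\boldsymbol\Sigma_h,\boldsymbol\Sigma_g,\boldsymbol\Sigma_\epsilon$. Set $\boldsymbol\Sigma_x=\boldsymbol\Sigma_\epsilon+\eta^2(\mathbf h\mathbf h^T+\boldsymbol\Sigma_h)$. For $l\in\{1,\dots,L\}$ let $m_l=\lceil l/N\rceil$ and $n_l=l-(m_l-1)N$. Let $\mathbf G\in\mathbb R^{L\times N}$ have entries $[\mathbf G]_{l,n}=g_{m_l}$ if $n=n_l$ and $0$ otherwise, and let $\mathbf H=\mathbf I_N\otimes\mathbf h\in\mathbb R^{L\times N}$ ($\otimes$ = Kronecker product). Define the symmetric positive semidefinite $L\times L$ matrices $$\boldsymbol\Omega_T=\mathbf I_N\otimes\boldsymbol\Sigma_x,\quad \boldsymbol\Omega_{JN}=\mathbf G\mathbf h\mathbf h^T\mathbf G^T,$$ $$\boldsymbol\Omega_{JD}=\mathbf G(\boldsymbol\Sigma_\epsilon+\eta^2\boldsymbol\Sigma_h)\mathbf G^T+\eta^2\mathbf H\boldsymbol\Sigma_g\mathbf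 H^T+\eta^2\,\boldsymbol\Sigma_g\otimes\boldsymbol\Sigma_h+\boldsymbol\Sigma_g\otimes\boldsymbol\Sigma_\epsilon .$$ For a symmetric positive definite matrix, the power $\pm\frac12$ denotes the symmetric positive definite square root (or its inverse). *)

theory Defs
  imports "HOL-Analysis.Analysis"
begin

text \<open>
  Indices: a finite type \<open>'n\<close> with \<open>N = CARD('n)\<close> stands for \<open>{1..N}\<close>, and \<open>'n \<times> 'n\<close> stands for
  \<open>{1..L}\<close> with \<open>L = N\<^sup>2\<close>: the index \<open>l = (m - 1) N + n\<close> is the pair \<open>(m, n)\<close>, so that
  \<open>m\<^sub>l = fst l\<close> and \<open>n\<^sub>l = snd l\<close>. Under this labelling the Kronecker product has the usual block
  structure, the first component being the block index.
\<close>

definition kron :: "real^'b^'a \<Rightarrow> real^'d^'c \<Rightarrow> real^('b::finite \<times> 'd::finite)^('a::finite \<times> 'c::finite)"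
  where "kron A B = (\<chi> i j. A $ fst i $ fst j * B $ snd i $ snd j)"

definition diag_mat :: "real^'a \<Rightarrow> real^'a^'a"
  where "diag_mat v = (\<chi> i j. if i = j then v $ i else 0)"

definition outer :: "real^'a \<Rightarrow> real^'b \<Rightarrow> real^'b^'a"
  where "outer x y = (columnvector x :: real^1^'a) ** (rowvector y :: real^'b^1)"

definition sym_posdef :: "real^'a^'a \<Rightarrow> bool"
  where "sym_posdef A \<longleftrightarrow> transpose A = A \<and> (\<forall>x. x \<noteq> 0 \<longrightarrow> x \<bullet> (A *v x) > 0)"

text \<open>Meaningful for symmetric positive definite \<open>A\<close>, where the square root exists and is unique.\<close>

definition mat_sqrt :: "real^'a^'a \<Rightarrow> real^'a^'a"
  where "mat_sqrt A = (THE B. sym_posdef B \<and> B ** B = A)"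

definition mat_inv_sqrt :: "real^'a^'a \<Rightarrow> real^'a^'a"
  where "mat_inv_sqrt A = matrix_inv (mat_sqrt A)"

definition Sigma_x :: "real \<Rightarrow> real^'n \<Rightarrow> real^'n^'n \<Rightarrow> real^'n^'n \<Rightarrow> real^'n^'n"
  where "Sigma_x \<eta> h Sh Se = Se + \<eta>\<^sup>2 *\<^sub>R (outer h h + Sh)"

definition G_mat :: "real^'n \<Rightarrow> real^'n^('n::finite \<times> 'n)"
  where "G_mat g = (\<chi> l n. if n = snd l then g $ fst l else 0)"

text \<open>
  \<open>I \<otimes> h\<close> with \<open>h\<close> read as an \<open>N \<times> 1\<close> matrix; its column index type \<open>'n \<times> 1\<close> is identified with \<open>'n\<close>.
\<close>

definition H_mat :: "real^'n \<Rightarrow> real^'n^('n::finite \<times> 'n)"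
  where "H_mat h = (\<chi> l k. kron (mat 1 :: real^'n^'n) (columnvector h :: real^1^'n) $ l $ (k, 1))"

definition Omega_T :: "real \<Rightarrow> real^'n \<Rightarrow> real^'n^'n \<Rightarrow> real^'n^'n
    \<Rightarrow> real^('n::finite \<times> 'n)^('n \<times> 'n)"
  where "Omega_T \<eta> h Sh Se = kron (mat 1) (Sigma_x \<eta> h Sh Se)"

definition Omega_JN :: "real^'n \<Rightarrow> real^'n \<Rightarrow> real^('n::finite \<times> 'n)^('n \<times> 'n)"
  where "Omega_JN h g = G_mat g ** outer h h ** transpose (G_mat g)"

definition Omega_JD :: "real \<Rightarrow> real^'n \<Rightarrow> real^'n \<Rightarrow> real^'n^'n \<Rightarrow> real^'n^'n \<Rightarrow> real^'n^'n
    \<Rightarrow> real^('n::finite \<times> 'n)^('n \<times> 'n)"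
  where "Omega_JD \<eta> h g Sh Sg Se =
    G_mat g ** (Se + \<eta>\<^sup>2 *\<^sub>R Sh) ** transpose (G_mat g)
    + \<eta>\<^sup>2 *\<^sub>R (H_mat h ** Sg ** transpose (H_mat h))
    + \<eta>\<^sup>2 *\<^sub>R kron Sg Sh + kron Sg Se"

text \<open>KKT conditions at \<open>w\<close> for minimising \<open>f\<close> subject to the single constraint \<open>c v \<le> 0\<close>.\<close>

definition kkt_point :: "('a::real_normed_vector \<Rightarrow> real) \<Rightarrow> ('a \<Rightarrow> real) \<Rightarrow> 'a \<Rightarrow> bool"
  where "kkt_point f c w \<longleftrightarrow>
    c w \<le> 0 \<and>
    (\<exists>\<mu>\<ge>0. \<mu> * c w = 0 \<and> ((\<lambda>v. f v + \<mu> * c v) has_derivative (\<lambda>_. 0)) (at w))"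

end

theory Submission
  imports Defs
begin

text \<open>
  With \<open>S\<close> the inverse square root of \<open>OTt\<close>, the substitution \<open>v = S U x\<close> turns the objective
  into \<open>\<bar>x\<bar>\<^sup>2 + 2 (q \<bullet> x)\<close> up to a constant, and the constraint into \<open>J \<xi>\<^sup>2 (x \<bullet> \<Lambda> x + 1) \<le> 0\<close>.
  Stationarity then reads \<open>(I + \<mu> \<Lambda>) x = - q\<close>, where \<open>\<mu> / (J \<xi>\<^sup>2)\<close> is the multiplier of the original
  constraint. Either \<open>\<mu> = 0\<close> is feasible, or a root of \<open>f\<close> makes the constraint active.
  The square root exists and is unique by the spectral theorem, obtained by extending a maximal
  orthonormal set of eigenvectors by a maximiser of the Rayleigh quotient on its orthogonal complement.
\<close>

section \<open>Spectral theorem for self-adjoint operators\<close>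

text \<open>The Rayleigh quotient attains its maximum on the compact unit sphere of
  \<open>S\<close>, and a maximiser is an eigenvector. The invariant subspace will be the orthogonal
  complement of eigenvectors already found.\<close>

lemma selfadjoint_eigenvector_in_subspace:
  fixes f :: "'a::euclidean_space \<Rightarrow> 'a"
  assumes "linear f" and sa: "\<And>x y. x \<bullet> f y = f x \<bullet> y"
    and S: "subspace S" "f ` S \<subseteq> S" "S \<noteq> {0}"
  obtains v c where "v \<in> S" "norm v = 1" "f v = c *\<^sub>R v"
proof -
  interpret linear f by fact
  obtain z where z: "z \<in> S" "z \<noteq> 0"
    using S subspace_0 by blast
  have "compact (S \<inter> sphere 0 1)"
    using S by (simp add: closed_Int_compact closed_subspace)
  moreover have "z /\<^sub>R norm z \<in> S \<inter> sphere 0 1"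
    using z S by (simp add: subspace_scale)
  moreover have "continuous_on (S \<inter> sphere 0 1) (\<lambda>x. x \<bullet> f x)"
    using \<open>linear f\<close>
    by (intro continuous_intros linear_continuous_on linear_conv_bounded_linear[THEN iffD1])
  ultimately obtain v where v: "v \<in> S" "norm v = 1"
    and max: "\<And>x. x \<in> S \<Longrightarrow> norm x = 1 \<Longrightarrow> x \<bullet> f x \<le> v \<bullet> f v"
    using continuous_attains_sup[of "S \<inter> sphere 0 1" "\<lambda>x. x \<bullet> f x"] by fastforce
  \<comment> \<open>The maximum \<open>c\<close> is the candidate eigenvalue. By homogeneity the
    form of \<open>c I - f\<close> is nonnegative on all of \<open>S\<close>, and it vanishes at
    \<open>v\<close>.\<close>
  define c where "c = v \<bullet> f v"
  define g where "g x = c *\<^sub>R x - f x" for x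
  have g_psd: "x \<bullet> g x \<ge> 0" if "x \<in> S" for x
  proof (cases "x = 0")
    case False
    have "(x /\<^sub>R norm x) \<bullet> f (x /\<^sub>R norm x) \<le> c"
      unfolding c_def using False that S by (intro max) (auto simp: subspace_scale)
    then have "x \<bullet> f x \<le> c * (norm x)\<^sup>2"
      using False by (simp add: scale field_simps power2_eq_square)
    then show ?thesis
      by (simp add: g_def inner_diff_right dot_square_norm)
  qed (simp add: g_def)
  define y where "y = g v"
  have "f v \<in> S"
    using v S by blast
  then have "y \<in> S"
    unfolding y_def g_def using v S by (simp add: subspace_diff subspace_scale)
  have "v \<bullet> g v = 0"
    using v by (simp add: g_def c_def inner_diff_right dot_square_norm)
  text \<open>\<open>v\<close> minimises the form \<open>x \<bullet> g x\<close> on \<open>S\<close>, so moving from \<open>v\<close> in direction \<open>-y\<close>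
    cannot make it negative; for small \<open>t\<close> this forces \<open>y = 0\<close>.\<close>
  have y_bound: "2 * t * (y \<bullet> y) \<le> t\<^sup>2 * (y \<bullet> g y)" for t
  proof -
    have "g (v - t *\<^sub>R y) = y - t *\<^sub>R g y"
      by (simp add: g_def[of "v - _"] g_def[of y] diff scale scaleR_diff_right)
        (simp add: y_def g_def algebra_simps)
    moreover have "v \<bullet> g y = y \<bullet> y"
      using sa[of v y] by (simp add: g_def y_def algebra_simps)
    moreover have "v \<bullet> y = 0"
      using \<open>v \<bullet> g v = 0\<close> by (simp add: y_def)
    ultimately have "(v - t *\<^sub>R y) \<bullet> g (v - t *\<^sub>R y) = t\<^sup>2 * (y \<bullet> g y) - 2 * t * (y \<bullet> y)"
      by (simp add: inner_diff_left inner_diff_right power2_eq_square right_diff_distrib)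
    moreover have "0 \<le> (v - t *\<^sub>R y) \<bullet> g (v - t *\<^sub>R y)"
      using v \<open>y \<in> S\<close> S by (intro g_psd) (simp add: subspace_diff subspace_scale)
    ultimately show ?thesis
      by simp
  qed
  have "y \<bullet> y \<le> 0"
  proof -
    define k where "k = y \<bullet> g y"
    have "k \<ge> 0"
      using g_psd \<open>y \<in> S\<close> by (simp add: k_def)
    show ?thesis
    proof (rule ccontr)
      assume "\<not> y \<bullet> y \<le> 0"
      then have yy: "y \<bullet> y > 0" by linarith
      \<comment> \<open>The summand 1 keeps the denominator positive even if \<open>k = 0\<close>,
        and \<open>k / (k + 1) \<le> 1\<close> yields \<open>t * k \<le> y \<bullet> y\<close>,
        against \<open>y_bound\<close>.\<close>
      define t where "t = (y \<bullet> y) / (k + 1)"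
      have "t > 0" using yy \<open>k \<ge> 0\<close> by (simp add: t_def)
      have "t * (2 * (y \<bullet> y)) \<le> t * (t * k)"
        using y_bound[of t] by (simp add: k_def power2_eq_square algebra_simps)
      with \<open>t > 0\<close> have "2 * (y \<bullet> y) \<le> t * k" by simp
      moreover have "t * k \<le> y \<bullet> y"
        using yy \<open>k \<ge> 0\<close> by (simp add: t_def field_simps)
      ultimately show False using yy by simp
    qed
  qed
  then have "y = 0"
    by (metis inner_gt_zero_iff not_le)
  then have "f v = c *\<^sub>R v"
    by (simp add: y_def g_def)
  with v show thesis
    by (rule that)
qed

text \<open>By orthonormality only the term of \<open>b\<close> survives. This evaluates an operator
  given by its eigenexpansion on a basis vector.\<close>

lemma pairwise_orthogonal_inner_sum:
  fixes E :: "'a::euclidean_space set"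
  assumes "finite E" "pairwise orthogonal E" "\<And>e. e \<in> E \<Longrightarrow> norm e = 1" "b \<in> E"
  shows "(\<Sum>e\<in>E. (e \<bullet> b) *\<^sub>R F e) = (F b :: 'b::real_vector)"
proof -
  have "(\<Sum>e\<in>E. (e \<bullet> b) *\<^sub>R F e) = (\<Sum>e\<in>E. if e = b then F e else 0)"
    using assms by (intro sum.cong) (auto simp: pairwise_def orthogonal_def dot_square_norm)
  with assms show ?thesis
    by simp
qed

text \<open>Self-adjointness makes the orthogonal complement of a set of eigenvectors invariant, so
  a nonzero complement would contain a further unit eigenvector.\<close>

theorem selfadjoint_orthonormal_eigenbasis:
  fixes f :: "'a::euclidean_space \<Rightarrow> 'a"
  assumes "linear f" and sa: "\<And>x y. x \<bullet> f y = f x \<bullet> y"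
  obtains E c where "finite E" "pairwise orthogonal E" "\<And>e. e \<in> E \<Longrightarrow> norm e = 1"
    "span E = UNIV" "\<And>e. e \<in> E \<Longrightarrow> f e = c e *\<^sub>R e"
proof -
  define P where "P E \<longleftrightarrow> pairwise orthogonal E \<and> (\<forall>e\<in>E. norm e = 1 \<and> (\<exists>c. f e = c *\<^sub>R e))"
    for E :: "'a set"
  have P_independent: "independent E" if "P E" for E
    using that by (intro pairwise_orthogonal_independent) (auto simp: P_def)
  have "P {}" by (simp add: P_def)
  \<comment> \<open>Orthonormal sets are independent, so the dimension bounds their cardinality and
    a largest one exists; \<open>Suc\<close> makes the bound strict.\<close>
  moreover have "\<forall>E. P E \<longrightarrow> card E < Suc DIM('a)"
    using independent_bound P_independent by (auto simp: less_Suc_eq_le)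
  ultimately obtain E where E: "P E" and max: "\<And>F. P F \<Longrightarrow> card F \<le> card E"
    using ex_has_greatest_nat[of P "{}" card "Suc DIM('a)"] by blast
  have fin: "finite E"
    using E P_independent independent_bound by blast
  define W where "W = {x. \<forall>e\<in>E. e \<bullet> x = 0}"
  have "span E = UNIV"
  proof (rule ccontr)
    assume "span E \<noteq> UNIV"
    then obtain z where "z \<noteq> 0" "\<And>x. x \<in> span E \<Longrightarrow> orthogonal z x"
      using span_not_UNIV_orthogonal[of E] by (auto simp: orthogonal_def)
    then have "z \<in> W"
      by (auto simp: W_def orthogonal_def inner_commute span_base)
    have "subspace W"
      by (auto simp: W_def subspace_def inner_add_right)
    moreover have "f ` W \<subseteq> W"
    proof -
      have "e \<bullet> f x = 0" if "e \<in> E" "x \<in> W" for e x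
        using E that by (auto simp: P_def W_def sa)
      then show ?thesis by (auto simp: W_def)
    qed
    ultimately obtain v c where v: "v \<in> W" "norm v = 1" "f v = c *\<^sub>R v"
      using selfadjoint_eigenvector_in_subspace[OF assms] \<open>z \<in> W\<close> \<open>z \<noteq> 0\<close> by blast
    have "v \<notin> E"
      using v by (auto simp: W_def)
    moreover have "P (insert v E)"
      using E v by (auto simp: P_def W_def pairwise_insert orthogonal_def inner_commute)
    ultimately show False
      using max[of "insert v E"] fin by simp
  qed
  moreover have "\<forall>e\<in>E. \<exists>c. f e = c *\<^sub>R e"
    using E by (auto simp: P_def)
  then obtain c where "\<forall>e\<in>E. f e = c e *\<^sub>R e"
    by metis
  ultimately show thesis
    using that[of E c] E fin by (auto simp: P_def)
qed

section \<open>Square roots of positive definite matrices\<close>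

lemma symmetric_inner_matrix_vector:
  fixes A :: "real^'n^'n"
  assumes "transpose A = A"
  shows "x \<bullet> (A *v y) = (A *v x) \<bullet> y"
  by (metis assms dot_lmul_matrix vector_transpose_matrix)

text \<open>Symmetry as self-adjointness can be checked for a matrix known only through its action
  on vectors.\<close>

lemma symmetric_matrix_iff_inner:
  fixes A :: "real^'n^'n"
  shows "transpose A = A \<longleftrightarrow> (\<forall>x y. x \<bullet> (A *v y) = (A *v x) \<bullet> y)"
proof
  assume *: "\<forall>x y. x \<bullet> (A *v y) = (A *v x) \<bullet> y"
  have "transpose A *v x = A *v x" for x
  proof (rule vector_eq_rdot[THEN iffD1], rule allI)
    fix y show "(transpose A *v x) \<bullet> y = (A *v x) \<bullet> y"
      using * by (simp add: dot_lmul_matrix)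
  qed
  then show "transpose A = A"
    by (simp add: matrix_eq)
qed (auto simp: symmetric_inner_matrix_vector)

lemma symmetric_matrix_eigenbasis:
  fixes A :: "real^'n^'n"
  assumes "transpose A = A"
  obtains E c where "finite E" "pairwise orthogonal E" "\<And>e. e \<in> E \<Longrightarrow> norm e = 1"
    "span E = UNIV" "\<And>e. e \<in> E \<Longrightarrow> A *v e = c e *\<^sub>R e"
  using selfadjoint_orthonormal_eigenbasis[OF matrix_vector_mul_linear
      symmetric_inner_matrix_vector[OF assms]]
  by blast

lemma matrix_eq_on_spanning_set:
  fixes A B :: "real^'n^'m"
  assumes "span E = UNIV" "\<And>e. e \<in> E \<Longrightarrow> A *v e = B *v e"
  shows "A = B"
proof -
  have "A *v x = B *v x" for x
    using linear_eq_on_span[OF matrix_vector_mul_linear matrix_vector_mul_linear, of E A B x] assms by auto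
  then show ?thesis
    by (simp add: matrix_eq)
qed

text \<open>In an orthonormal eigenbasis the root multiplies each eigenvector by the square root of
  its positive eigenvalue.\<close>

lemma sym_posdef_sqrt_exists:
  fixes A :: "real^'n^'n"
  assumes "sym_posdef A"
  shows "\<exists>B. sym_posdef B \<and> B ** B = A"
proof -
  obtain E c where E: "finite E" "pairwise orthogonal E" "\<And>e. e \<in> E \<Longrightarrow> norm e = 1"
    "span E = UNIV" and c: "\<And>e. e \<in> E \<Longrightarrow> A *v e = c e *\<^sub>R e"
    using symmetric_matrix_eigenbasis[of A] assms unfolding sym_posdef_def by metis
  have c_pos: "c e > 0" if "e \<in> E" for e
  proof -
    have "e \<bullet> (A *v e) > 0"
      using assms E(3)[OF that] by (metis norm_zero sym_posdef_def zero_neq_one)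
    then show ?thesis
      using that E(3) by (simp add: c dot_square_norm)
  qed
  define F where "F x = (\<Sum>e\<in>E. (e \<bullet> x) *\<^sub>R (sqrt (c e) *\<^sub>R e))" for x
  have "linear F"
    by (intro linearI)
      (simp_all add: F_def algebra_simps sum.distrib scaleR_sum_right)
  define B where "B = matrix F"
  have B: "B *v x = F x" for x
    using \<open>linear F\<close> by (simp add: B_def matrix_works)
  have B_eig: "B *v e = sqrt (c e) *\<^sub>R e" if "e \<in> E" for e
    unfolding B F_def using E that by (intro pairwise_orthogonal_inner_sum)
  have "B ** B = A"
  proof (rule matrix_eq_on_spanning_set[OF E(4)])
    fix e assume e: "e \<in> E"
    have "(B ** B) *v e = (sqrt (c e) * sqrt (c e)) *\<^sub>R e"
      using e by (simp add: matrix_vector_mul_assoc[symmetric] B_eig matrix_vector_mult_scaleR)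
    then show "(B ** B) *v e = A *v e"
      using c_pos[OF e] by (simp add: c e)
  qed
  moreover have "transpose B = B"
    unfolding symmetric_matrix_iff_inner B F_def
    by (auto simp: inner_sum_left inner_sum_right inner_commute intro!: sum.cong)
  moreover have "x \<bullet> (B *v x) > 0" if "x \<noteq> 0" for x
  proof -
    \<comment> \<open>As \<open>E\<close> spans, a vector orthogonal to all of \<open>E\<close> is
      orthogonal to itself. The basis vector found here gives a strictly positive term in the sum
      below.\<close>
    have "\<exists>e\<in>E. e \<bullet> x \<noteq> 0"
    proof (rule ccontr)
      assume "\<not> (\<exists>e\<in>E. e \<bullet> x \<noteq> 0)"
      then have "orthogonal x x"
        using E(4) by (intro orthogonal_to_span[of x E]) (auto simp: orthogonal_def inner_commute)
      with that show False
        by (simp add: orthogonal_self)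
    qed
    then obtain e0 where "e0 \<in> E" "e0 \<bullet> x \<noteq> 0" by blast
    have "x \<bullet> (B *v x) = (\<Sum>e\<in>E. sqrt (c e) * (e \<bullet> x)\<^sup>2)"
      by (auto simp: B F_def inner_sum_right inner_commute power2_eq_square intro!: sum.cong)
    also have "\<dots> > 0"
      using E(1) \<open>e0 \<in> E\<close> \<open>e0 \<bullet> x \<noteq> 0\<close> c_pos
      by (intro sum_pos2[of E e0]) (auto intro!: mult_nonneg_nonneg less_imp_le[OF c_pos])
    finally show ?thesis .
  qed
  ultimately show ?thesis
    by (auto simp: sym_posdef_def)
qed

text \<open>The difference \<open>D\<close> of two square roots is symmetric. On an eigenvector \<open>e\<close> with
  eigenvalue \<open>c\<close>, \<open>0 = \<bar>B e\<bar>\<^sup>2 - \<bar>C e\<bar>\<^sup>2 = c (e \<bullet> (B + C) e)\<close>, so \<open>c = 0\<close>.\<close>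

lemma sym_posdef_sqrt_unique:
  fixes B C :: "real^'n^'n"
  assumes B: "sym_posdef B" and C: "sym_posdef C" and eq: "B ** B = C ** C"
  shows "B = C"
proof -
  have sym: "transpose B = B" "transpose C = C"
    using B C by (auto simp: sym_posdef_def)
  have "transpose (B - C) = B - C"
    using sym by (simp add: transpose_def vec_eq_iff)
  then obtain E c where E: "\<And>e. e \<in> E \<Longrightarrow> norm e = 1" "span E = UNIV"
    and c: "\<And>e. e \<in> E \<Longrightarrow> (B - C) *v e = c e *\<^sub>R e"
    using symmetric_matrix_eigenbasis[of "B - C"] by metis
  show ?thesis
  proof (rule matrix_eq_on_spanning_set[OF E(2)])
    fix e assume e: "e \<in> E"
    have Be: "B *v e = C *v e + c e *\<^sub>R e"
      using c[OF e] by (simp add: algebra_simps)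
    have "(B *v e) \<bullet> (B *v e) = (C *v e) \<bullet> (C *v e)"
      using arg_cong[OF eq, of "\<lambda>X. e \<bullet> (X *v e)"] sym
      by (simp add: matrix_vector_mul_assoc[symmetric] symmetric_inner_matrix_vector)
    moreover have "(B *v e) \<bullet> (B *v e) - (C *v e) \<bullet> (C *v e) = (B *v e - C *v e) \<bullet> (B *v e + C *v e)"
      by (simp add: algebra_simps inner_commute)
    ultimately have "c e * (e \<bullet> (B *v e) + e \<bullet> (C *v e)) = 0"
      by (simp add: Be inner_commute[of e "C *v e"] algebra_simps)
    moreover have "e \<noteq> 0"
      using E(1)[OF e] by auto
    then have "e \<bullet> (B *v e) + e \<bullet> (C *v e) > 0"
      using B C by (simp add: sym_posdef_def add_pos_pos)
    ultimately have "c e = 0"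
      by simp
    with Be show "B *v e = C *v e"
      by simp
  qed
qed

text \<open>Existence and uniqueness together turn the definite description into an actual
  root.\<close>

lemma mat_sqrt:
  fixes A :: "real^'n^'n"
  assumes "sym_posdef A"
  shows "sym_posdef (mat_sqrt A)" "mat_sqrt A ** mat_sqrt A = A"
proof -
  have "\<exists>!B. sym_posdef B \<and> B ** B = A"
    using sym_posdef_sqrt_exists[OF assms] sym_posdef_sqrt_unique by blast
  from theI'[OF this] show "sym_posdef (mat_sqrt A)" "mat_sqrt A ** mat_sqrt A = A"
    by (auto simp: mat_sqrt_def)
qed

section \<open>Inverses and inverse square roots\<close>

lemma sym_posdef_invertible:
  fixes A :: "real^'n^'n"
  assumes "sym_posdef A"
  shows "invertible A"
proof -
  have "x = 0" if "A *v x = 0" for x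
    using assms that unfolding sym_posdef_def by (metis inner_zero_right less_irrefl)
  then show ?thesis
    by (simp add: invertible_left_inverse matrix_left_invertible_ker)
qed

lemma matrix_inv_cancel:
  fixes A :: "real^'n^'n"
  assumes "invertible A"
  shows "A ** matrix_inv A = mat 1" "matrix_inv A ** A = mat 1"
  using someI_ex[OF assms[unfolded invertible_def]] by (auto simp: matrix_inv_def)

lemma matrix_inv_vector_eqI:
  fixes A :: "real^'n^'n"
  assumes "invertible A" "A *v y = x"
  shows "matrix_inv A *v x = y"
  using assms matrix_inv_cancel(2)[OF assms(1)] by (metis matrix_vector_mul_assoc matrix_vector_mul_lid)

lemma mat_inv_sqrt:
  fixes A :: "real^'n^'n"
  assumes "sym_posdef A"
  shows "transpose (mat_inv_sqrt A) = mat_inv_sqrt A"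
    and "mat_inv_sqrt A ** A ** mat_inv_sqrt A = mat 1"
    and "mat_inv_sqrt A ** mat_sqrt A = mat 1"
    and "mat_sqrt A ** mat_inv_sqrt A = mat 1"
proof -
  let ?B = "mat_sqrt A" and ?S = "mat_inv_sqrt A"
  have inv: "?B ** ?S = mat 1" "?S ** ?B = mat 1"
    unfolding mat_inv_sqrt_def
    using matrix_inv_cancel[OF sym_posdef_invertible[OF mat_sqrt(1)[OF assms]]] by auto
  then show "?S ** ?B = mat 1" "?B ** ?S = mat 1" by auto
  have "transpose ?B = ?B"
    using mat_sqrt(1)[OF assms] by (simp add: sym_posdef_def)
  \<comment> \<open>Transposing \<open>?S ** ?B = mat 1\<close> exhibits \<open>transpose ?S\<close>
    as a right inverse of \<open>?B\<close>, which must agree with the left inverse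
    \<open>?S\<close>.\<close>
  then have "?B ** transpose ?S = mat 1"
    by (metis inv(2) matrix_transpose_mul transpose_mat)
  then show "transpose ?S = ?S"
    by (metis inv(2) matrix_mul_assoc matrix_mul_lid matrix_mul_rid)
  show "?S ** A ** ?S = mat 1"
    by (metis inv mat_sqrt(2)[OF assms] matrix_mul_assoc matrix_mul_lid)
qed

section \<open>The objective matrix\<close>

lemma matrix_vector_mult_minus:
  fixes A :: "real^'n^'m"
  shows "A *v (- x) = - (A *v x)"
  by (rule linear_neg[OF matrix_vector_mul_linear])

lemma transpose_scaleR_real: "transpose (c *\<^sub>R A) = c *\<^sub>R transpose (A :: real^'n^'m)"
  by (simp add: transpose_def vec_eq_iff)

lemma sym_posdef_add_psd:
  fixes A B :: "real^'n^'n"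
  assumes "sym_posdef A" "transpose B = B" "\<And>x. x \<bullet> (B *v x) \<ge> 0"
  shows "sym_posdef (A + B)"
proof -
  have "transpose (A + B) = A + B"
    using assms by (simp add: sym_posdef_def transpose_def vec_eq_iff)
  moreover have "x \<bullet> ((A + B) *v x) > 0" if "x \<noteq> 0" for x
    using assms that
    by (simp add: sym_posdef_def matrix_vector_mult_add_rdistrib inner_add_right add_pos_nonneg)
  ultimately show ?thesis
    by (simp add: sym_posdef_def)
qed

lemma sym_posdef_imp_psd: "sym_posdef A \<Longrightarrow> x \<bullet> (A *v x) \<ge> 0"
  by (cases "x = 0") (auto simp: sym_posdef_def less_imp_le)

lemma outer_nth: "outer x y $ i $ j = x $ i * y $ j"
  by (simp add: outer_def matrix_matrix_mult_def columnvector_def rowvector_def)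

lemma outer_mult_vector: "outer x y *v z = (y \<bullet> z) *\<^sub>R x"
  by (simp add: vec_eq_iff matrix_vector_mult_def outer_nth inner_vec_def sum_distrib_right
      sum_distrib_left mult_ac)

lemma sym_posdef_Sigma_x:
  assumes "sym_posdef Sh" "sym_posdef Se"
  shows "sym_posdef (Sigma_x \<eta> h Sh Se)"
  unfolding Sigma_x_def
proof (rule sym_posdef_add_psd[OF assms(2)])
  show "transpose (\<eta>\<^sup>2 *\<^sub>R (outer h h + Sh)) = \<eta>\<^sup>2 *\<^sub>R (outer h h + Sh)"
    using assms(1) by (simp add: sym_posdef_def transpose_def vec_eq_iff outer_nth mult.commute)
  show "x \<bullet> (\<eta>\<^sup>2 *\<^sub>R (outer h h + Sh) *v x) \<ge> 0" for x
    using sym_posdef_imp_psd[OF assms(1), of x]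
    by (simp add: scaleR_matrix_vector_assoc[symmetric] matrix_vector_mult_add_rdistrib inner_add_right
        outer_mult_vector inner_commute)
qed

text \<open>The matrix is block diagonal with copies of \<open>S\<close>, so its quadratic form
  splits over the blocks, indexed by the first component.\<close>

lemma inner_kron_mat_1:
  fixes S :: "real^'n^'n" and x :: "real^('m::finite \<times> 'n)"
  shows "x \<bullet> (kron (mat 1) S *v x) = (\<Sum>m\<in>UNIV. (\<chi> n. x $ (m, n)) \<bullet> (S *v (\<chi> n. x $ (m, n))))"
proof -
  have "(kron (mat 1 :: real^'m^'m) S *v x) $ (m, n) = (S *v (\<chi> n. x $ (m, n))) $ n" for m n
  proof -
    have "(kron (mat 1 :: real^'m^'m) S *v x) $ (m, n)
        = (\<Sum>m'\<in>UNIV. \<Sum>n'\<in>UNIV. (if m = m' then 1 else 0) * S $ n $ n' * x $ (m', n'))"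
      by (simp add: matrix_vector_mult_def kron_def mat_def UNIV_Times_UNIV[symmetric]
          sum.cartesian_product split_def del: UNIV_Times_UNIV)
    also have "\<dots> = (\<Sum>m'\<in>UNIV. if m = m' then \<Sum>n'\<in>UNIV. S $ n $ n' * x $ (m', n') else 0)"
      by (intro sum.cong) auto
    finally show ?thesis
      by (simp add: matrix_vector_mult_def)
  qed
  then have "(kron (mat 1 :: real^'m^'m) S *v x) $ i = (S *v (\<chi> n. x $ (fst i, n))) $ snd i" for i
    by (metis prod.collapse)
  then show ?thesis
    by (simp add: inner_vec_def UNIV_Times_UNIV[symmetric] sum.cartesian_product split_def
        del: UNIV_Times_UNIV)
qed

lemma transpose_Omega_T:
  assumes "sym_posdef Sh" "sym_posdef Se"
  shows "transpose (Omega_T \<eta> h Sh Se) = Omega_T \<eta> h Sh Se"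
  using sym_posdef_Sigma_x[OF assms, of \<eta> h]
  by (auto simp: sym_posdef_def Omega_T_def kron_def transpose_def vec_eq_iff mat_def)

lemma Omega_T_psd:
  assumes "sym_posdef Sh" "sym_posdef Se"
  shows "x \<bullet> (Omega_T \<eta> h Sh Se *v x) \<ge> 0"
  unfolding Omega_T_def inner_kron_mat_1
  by (intro sum_nonneg sym_posdef_imp_psd sym_posdef_Sigma_x assms)

lemma sym_posdef_scaled_identity: "r > 0 \<Longrightarrow> sym_posdef (r *\<^sub>R mat 1 :: real^'n^'n)"
  by (auto simp: sym_posdef_def transpose_scaleR_real scaleR_matrix_vector_assoc[symmetric])

section \<open>KKT points of the quadratic program\<close>

text \<open>Symmetry merges the two terms of the product rule.\<close>

lemma has_derivative_quadratic_form:
  fixes A :: "real^'n^'n"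
  assumes "transpose A = A"
  shows "((\<lambda>v. v \<bullet> (A *v v)) has_derivative (\<lambda>d. 2 * (d \<bullet> (A *v w)))) (at w)"
proof -
  have "((*v) A has_derivative (*v) A) (at w)"
    by (intro bounded_linear_imp_has_derivative matrix_vector_mul_bounded_linear)
  from has_derivative_inner[OF has_derivative_ident this] show ?thesis
    by (simp add: symmetric_inner_matrix_vector[OF assms, of w] inner_commute)
qed

text \<open>The gradient of the Lagrangian at \<open>w\<close> is
  \<open>2 (A w + \<mu> M w) + \<rho> (w - a)\<close>; the stationarity assumption sets half of it
  to zero, with the term in \<open>a\<close> moved to the right.\<close>

lemma kkt_pointI:
  fixes A M :: "real^'n^'n"
  assumes sym: "transpose A = A" "transpose M = M"
    and feasible: "w \<bullet> (M *v w) + k \<le> 0"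
    and \<mu>: "\<mu> \<ge> 0" "\<mu> * (w \<bullet> (M *v w) + k) = 0"
    and stationary: "(A + (\<rho> / 2) *\<^sub>R mat 1) *v w + \<mu> *\<^sub>R (M *v w) = (\<rho> / 2) *\<^sub>R a"
  shows "kkt_point (\<lambda>v. v \<bullet> (A *v v) + \<rho> / 2 * (norm (v - a))\<^sup>2) (\<lambda>v. v \<bullet> (M *v v) + k) w"
  unfolding kkt_point_def
proof (intro conjI exI[of _ \<mu>])
  have "((\<lambda>v. v \<bullet> (A *v v) + \<rho> / 2 * ((v - a) \<bullet> (v - a)) + \<mu> * (v \<bullet> (M *v v) + k))
      has_derivative (\<lambda>d. 2 * (d \<bullet> (A *v w)) + \<rho> / 2 * ((w - a) \<bullet> d + d \<bullet> (w - a))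
        + \<mu> * (2 * (d \<bullet> (M *v w))))) (at w)"
    by (rule derivative_eq_intros has_derivative_quadratic_form sym refl | simp)+
  moreover have "2 * (d \<bullet> (A *v w)) + \<rho> / 2 * ((w - a) \<bullet> d + d \<bullet> (w - a))
      + \<mu> * (2 * (d \<bullet> (M *v w))) = 0" for d
    using arg_cong[OF stationary, of "\<lambda>v. 2 * (d \<bullet> v)"]
    by (simp add: scaleR_matrix_vector_assoc[symmetric] inner_commute[of _ d] algebra_simps)
  ultimately show "((\<lambda>v. v \<bullet> (A *v v) + \<rho> / 2 * (norm (v - a))\<^sup>2 + \<mu> * (v \<bullet> (M *v v) + k))
      has_derivative (\<lambda>_. 0)) (at w)"
    by (simp add: power2_norm_eq_inner)
qed (use feasible \<mu> in auto)

section \<open>Reduction to the diagonalised problem\<close>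

lemma diag_mat_mult_vector: "diag_mat v *v x = (\<chi> i. v $ i * x $ i)"
  by (simp add: diag_mat_def matrix_vector_mult_def vec_eq_iff
      if_distrib[where f = "\<lambda>z. z * _"] cong: if_cong)

lemma transpose_diag_mat: "transpose (diag_mat v) = diag_mat v"
  by (auto simp: diag_mat_def transpose_def vec_eq_iff)

theorem proposition1:
  fixes \<eta> \<xi> J \<rho> \<mu>0 :: real
    and h g :: "real^'n"
    and Sh Sg Se :: "real^'n^'n"
    and a lam q u w :: "real^('n \<times> 'n)"
    and OT M OTt U \<Lambda> :: "real^('n \<times> 'n)^('n \<times> 'n)"
  assumes "\<eta>\<^sup>2 > 0" and "\<xi>\<^sup>2 > 0" and "J > 0" and "\<rho> > 0"
    and "sym_posdef Sh" and "sym_posdef Sg" and "sym_posdef Se"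
    and "OT = Omega_T \<eta> h Sh Se"
    and "M = J *\<^sub>R Omega_JD \<eta> h g Sh Sg Se - Omega_JN h g"
    and "OTt = OT + (\<rho> / 2) *\<^sub>R mat 1"
    and "orthogonal_matrix U"
    and "\<Lambda> = diag_mat lam"
    and "(1 / (J * \<xi>\<^sup>2)) *\<^sub>R (mat_inv_sqrt OTt ** M ** mat_inv_sqrt OTt) = U ** \<Lambda> ** transpose U"
    and "q = - (\<rho> / 2) *\<^sub>R (transpose U *v (mat_inv_sqrt OTt *v a))"
    and "\<not> q \<bullet> (\<Lambda> *v q) + 1 \<le> 0 \<longrightarrow>
           \<mu>0 > 0 \<and> (\<forall>l. \<mu>0 * lam $ l + 1 \<noteq> 0) \<and>
           (\<Sum>l\<in>UNIV. lam $ l * (q $ l)\<^sup>2 / (\<mu>0 * lam $ l + 1)\<^sup>2) + 1 = 0"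
    and "u = (if q \<bullet> (\<Lambda> *v q) + 1 \<le> 0 then - q
              else - (matrix_inv (mat 1 + \<mu>0 *\<^sub>R \<Lambda>) *v q))"
    and "w = mat_inv_sqrt OTt *v (U *v u)"
  shows "kkt_point (\<lambda>v. v \<bullet> (OT *v v) + \<rho> / 2 * (norm (v - a))\<^sup>2)
                   (\<lambda>v. v \<bullet> (M *v v) + J * \<xi>\<^sup>2) w"
proof -
  define S B where "S = mat_inv_sqrt OTt" and "B = mat_sqrt OTt"
  define k where "k = J * \<xi>\<^sup>2"
  have "k > 0"
    using assms(2,3) by (simp add: k_def)
  have OT_sym: "transpose OT = OT"
    using assms(5,7,8) by (simp add: transpose_Omega_T)
  \<comment> \<open>The shift by a positive multiple of the identity is the positive definite
    summand; \<open>OT\<close> enters as the semidefinite one, hence the swap of the sum.\<close>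
  have "sym_posdef OTt"
    unfolding assms(10) using assms(4,5,7,8) OT_sym
    by (subst add.commute)
      (intro sym_posdef_add_psd sym_posdef_scaled_identity, auto simp: Omega_T_psd)
  note S = mat_inv_sqrt[OF this, folded S_def B_def]
  have B_sym: "transpose B = B"
    using mat_sqrt(1)[OF \<open>sym_posdef OTt\<close>] by (simp add: B_def sym_posdef_def)
  have U: "transpose U ** U = mat 1" "U ** transpose U = mat 1"
    using assms(11) by (auto simp: orthogonal_matrix_def)
  have SMS: "S ** M ** S = k *\<^sub>R (U ** \<Lambda> ** transpose U)"
    using \<open>k > 0\<close> by (simp flip: assms(13)[folded S_def k_def])
  text \<open>The symmetry of \<open>M\<close> comes for free from its given diagonalisation.\<close>
  have "M = B ** (S ** M ** S) ** B"
    using S(3,4) by (metis matrix_mul_assoc matrix_mul_lid matrix_mul_rid)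
  also have "transpose \<dots> = \<dots>"
    by (simp add: SMS matrix_transpose_mul transpose_scaleR_real B_sym assms(12) transpose_diag_mat
        matrix_mul_assoc)
  finally have M_sym: "transpose M = M" .

  \<comment> \<open>This and the next two facts express the terms of the stationarity condition,
    multiplied by the invertible \<open>S\<close>, through \<open>u\<close> and
    \<open>q\<close>.\<close>
  have SMw: "S *v (M *v w) = k *\<^sub>R (U *v (\<Lambda> *v u))"
  proof -
    have "S *v (M *v w) = (S ** M ** S) *v (U *v u)"
      by (simp add: assms(17) S_def matrix_vector_mul_assoc matrix_mul_assoc)
    also have "\<dots> = k *\<^sub>R ((U ** \<Lambda> ** (transpose U ** U)) *v u)"
      by (simp only: SMS scaleR_matrix_vector_assoc[symmetric] matrix_vector_mul_assoc[symmetric])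
    finally show ?thesis
      by (simp add: U matrix_vector_mul_assoc)
  qed
  have SOw: "S *v (OTt *v w) = U *v u"
    using S(2) by (simp add: assms(17) S_def[symmetric] matrix_vector_mul_assoc matrix_mul_assoc)
  have Sa: "(\<rho> / 2) *\<^sub>R (S *v a) = - (U *v q)"
    by (simp add: assms(14) S_def[symmetric] matrix_vector_mult_scaleR matrix_vector_mul_assoc
        matrix_vector_mult_minus matrix_mul_assoc U)
  \<comment> \<open>The symmetric \<open>S\<close> moves across the inner product, and the
    orthogonal \<open>U\<close> preserves it, which leaves the diagonal form.\<close>
  have constraint: "w \<bullet> (M *v w) + k = k * (u \<bullet> (\<Lambda> *v u) + 1)"
  proof -
    have "w \<bullet> (M *v w) = (U *v u) \<bullet> (S *v (M *v w))"
      by (simp add: assms(17) S_def[symmetric] symmetric_inner_matrix_vector[OF S(1)])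
    also have "\<dots> = k * ((U *v u) \<bullet> (U *v (\<Lambda> *v u)))"
      by (simp add: SMw)
    also have "(U *v u) \<bullet> (U *v (\<Lambda> *v u)) = u \<bullet> (\<Lambda> *v u)"
      using dot_lmul_matrix[of u "transpose U" "U *v (\<Lambda> *v u)"]
      by (simp add: matrix_vector_mul_assoc matrix_mul_assoc U)
    finally show ?thesis
      by (simp add: algebra_simps)
  qed
  \<comment> \<open>The KKT conditions in the coordinates \<open>u\<close>. Since
    \<open>\<Lambda>\<close> diagonalises the constraint matrix only after division by
    \<open>k\<close>, the original multiplier is \<open>\<mu> / k\<close>.\<close>
  have kkt: ?thesis
    if "\<mu> \<ge> 0" "u \<bullet> (\<Lambda> *v u) + 1 \<le> 0" "\<mu> * (u \<bullet> (\<Lambda> *v u) + 1) = 0"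
      "u + \<mu> *\<^sub>R (\<Lambda> *v u) = - q" for \<mu>
    unfolding k_def[symmetric]
  proof (rule kkt_pointI[OF OT_sym M_sym, where \<mu> = "\<mu> / k"])
    show "w \<bullet> (M *v w) + k \<le> 0"
      unfolding constraint using that \<open>k > 0\<close> by (simp add: mult_le_0_iff)
    show "\<mu> / k \<ge> 0" "\<mu> / k * (w \<bullet> (M *v w) + k) = 0"
      unfolding constraint using that \<open>k > 0\<close> by auto
    have "S *v (OTt *v w + (\<mu> / k) *\<^sub>R (M *v w)) = U *v (u + \<mu> *\<^sub>R (\<Lambda> *v u))"
      using \<open>k > 0\<close> by (simp add: matrix_vector_right_distrib matrix_vector_mult_scaleR SOw SMw)
    also have "\<dots> = S *v ((\<rho> / 2) *\<^sub>R a)"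
      by (simp only: that(4) matrix_vector_mult_scaleR Sa matrix_vector_mult_minus)
    \<comment> \<open>\<open>B\<close> is the inverse of \<open>S\<close>, so applying it removes
      the factor \<open>S\<close> from both sides.\<close>
    finally have "B *v (S *v (OTt *v w + (\<mu> / k) *\<^sub>R (M *v w))) = B *v (S *v ((\<rho> / 2) *\<^sub>R a))"
      by simp
    then show "(OT + (\<rho> / 2) *\<^sub>R mat 1) *v w + (\<mu> / k) *\<^sub>R (M *v w) = (\<rho> / 2) *\<^sub>R a"
      by (simp add: matrix_vector_mul_assoc S(4) assms(10))
  qed
  show ?thesis
  proof (cases "q \<bullet> (\<Lambda> *v q) + 1 \<le> 0")
    case True
    then have "u = - q"
      using assms(16) by simp
    \<comment> \<open>Here \<open>- q\<close> minimises the transformed objective without any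
      constraint, so the multiplier is 0; the quadratic form agrees at \<open>q\<close> and
      \<open>- q\<close>.\<close>
    with True show ?thesis
      by (intro kkt[of 0]) (auto simp: matrix_vector_mult_minus)
  next
    case False
    then have \<mu>0: "\<mu>0 > 0" "\<And>l. \<mu>0 * lam $ l + 1 \<noteq> 0"
      and root: "(\<Sum>l\<in>UNIV. lam $ l * (q $ l)\<^sup>2 / (\<mu>0 * lam $ l + 1)\<^sup>2) + 1 = 0"
      using assms(15) by auto
    \<comment> \<open>The matrix acts entrywise by factors that do not vanish, so it is invertible
      and its inverse divides by them.\<close>
    have mult: "((mat 1 + \<mu>0 *\<^sub>R \<Lambda>) *v x) $ l = (\<mu>0 * lam $ l + 1) * x $ l" for x l
      by (simp add: scaleR_matrix_vector_assoc[symmetric] assms(12) diag_mat_mult_vector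
          algebra_simps)
    have "x = 0" if "(mat 1 + \<mu>0 *\<^sub>R \<Lambda>) *v x = 0" for x
      using \<mu>0(2) mult[of x] that by (simp add: vec_eq_iff)
    then have "invertible (mat 1 + \<mu>0 *\<^sub>R \<Lambda>)"
      by (simp add: invertible_left_inverse matrix_left_invertible_ker)
    then have "matrix_inv (mat 1 + \<mu>0 *\<^sub>R \<Lambda>) *v q = (\<chi> l. q $ l / (\<mu>0 * lam $ l + 1))"
      using \<mu>0(2) by (intro matrix_inv_vector_eqI) (simp_all add: vec_eq_iff mult)
    with False have u: "u $ l = - q $ l / (\<mu>0 * lam $ l + 1)" for l
      using assms(16) by simp
    \<comment> \<open>With 1 added, the right-hand side is \<open>f\<close> at \<mu>0. A root thus
      makes the constraint active, which gives complementary slackness for a positive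
      multiplier.\<close>
    have "u \<bullet> (\<Lambda> *v u) = (\<Sum>l\<in>UNIV. lam $ l * (q $ l)\<^sup>2 / (\<mu>0 * lam $ l + 1)\<^sup>2)"
      by (simp add: assms(12) diag_mat_mult_vector inner_vec_def u power2_eq_square mult_ac)
    then have active: "u \<bullet> (\<Lambda> *v u) + 1 = 0"
      using root by simp
    have "u + \<mu>0 *\<^sub>R (\<Lambda> *v u) = (mat 1 + \<mu>0 *\<^sub>R \<Lambda>) *v u"
      by (simp add: matrix_vector_mult_add_rdistrib scaleR_matrix_vector_assoc[symmetric])
    also have "\<dots> = - q"
      using \<mu>0(2) by (simp add: vec_eq_iff mult u)
    finally show ?thesis
      using \<mu>0(1) active by (intro kkt[of \<mu>0]) auto
  qed
qed

end
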